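(* Let $K\subset\mathbb{R}^n$ be a self-dual convex cone and let $q$ be a quadratic form on $\mathbb{R}^n$ with matrix $Q$. Then $q\in \mathrm{SL}^2(K)$ if and only if $Q$ has exactly one positive eigenvalue and $Q$ is $K$-nonnegative.
   Context: The matrix of $q$ is the symmetric matrix $Q$ with $q(x)=x^tQx$. $K$ is self-dual if $K=K^*=\{y\in\mathbb{R}^n : \langle y,x\rangle\ge 0 \text{ for all } x\in K\}$ (such a cone is closed, pointed and has nonempty interior). $\mathrm{SL}^2(K)$ is the set of $K$-Lorentzian quadratic forms, i.e. quadratic forms $q$ such that $Q$ has exactly one positive eigenvalue and $y^tQx>0$ for all $x,y\in\mathrm{int}\,K$. An $n\times n$ matrix $A$ is $K$-nonnegative if $A(K)\subseteq K$. *)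

theory Defs
  imports "HOL-Analysis.Analysis"
begin

definition has_matrix :: "(real^'n \<Rightarrow> real) \<Rightarrow> real^'n^'n \<Rightarrow> bool" where
  "has_matrix q Q \<longleftrightarrow> transpose Q = Q \<and> (\<forall>x. q x = x \<bullet> (Q *v x))"

definition quadratic_form :: "(real^'n \<Rightarrow> real) \<Rightarrow> bool" where
  "quadratic_form q \<longleftrightarrow> (\<exists>Q. has_matrix q Q)"

lemma has_matrix_unique:
  fixes q :: "real^'n \<Rightarrow> real"
  assumes "has_matrix q Q" and "has_matrix q R"
  shows "Q = R"
proof -
  have polar: "x \<bullet> (M *v y) = (q (x + y) - q x - q y) / 2"
    if M: "has_matrix q M" for M :: "real^'n^'n" and x y :: "real^'n"
  proof -
    have "y \<bullet> (M *v x) = (transpose M *v y) \<bullet> x"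
      by (simp add: dot_lmul_matrix)
    also have "\<dots> = x \<bullet> (M *v y)"
      using M by (simp add: has_matrix_def inner_commute)
    finally show ?thesis
      using M by (simp add: has_matrix_def matrix_vector_right_distrib
          inner_add_left inner_add_right)
  qed
  have "x \<bullet> (Q *v y) = x \<bullet> (R *v y)" for x y
    by (simp only: polar[OF assms(1)] polar[OF assms(2)])
  then have "Q *v y = R *v y" for y
    by (blast intro: vector_eq_ldot[THEN iffD1])
  then show ?thesis
    by (simp add: matrix_eq)
qed

definition matrix_of :: "(real^'n \<Rightarrow> real) \<Rightarrow> real^'n^'n" where
  "matrix_of q = (THE Q. has_matrix q Q)"

lemma matrix_of_eq: "has_matrix q Q \<Longrightarrow> matrix_of q = Q"
  unfolding matrix_of_def by (blast intro: has_matrix_unique)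

definition eigenspace :: "real^'n^'n \<Rightarrow> real \<Rightarrow> (real^'n) set" where
  "eigenspace A c = {v. A *v v = c *\<^sub>R v}"

definition eigenvalue :: "real^'n^'n \<Rightarrow> real \<Rightarrow> bool" where
  "eigenvalue A c \<longleftrightarrow> (\<exists>v. v \<noteq> 0 \<and> v \<in> eigenspace A c)"

(* Eigenvalues are counted with multiplicity. The definition is only applied to
   symmetric matrices, where the multiplicity is the dimension of the eigenspace. *)
definition one_positive_eigenvalue :: "real^'n^'n \<Rightarrow> bool" where
  "one_positive_eigenvalue A \<longleftrightarrow>
     (\<exists>c. {d. eigenvalue A d \<and> 0 < d} = {c} \<and> dim (eigenspace A c) = 1)"

definition dual_cone :: "(real^'n) set \<Rightarrow> (real^'n) set" where
  "dual_cone K = {y. \<forall>x\<in>K. 0 \<le> y \<bullet> x}"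

definition self_dual :: "(real^'n) set \<Rightarrow> bool" where
  "self_dual K \<longleftrightarrow> K = dual_cone K"

definition SL2 :: "(real^'n) set \<Rightarrow> (real^'n \<Rightarrow> real) set" where
  "SL2 K = {q. quadratic_form q \<and> one_positive_eigenvalue (matrix_of q) \<and>
     (\<forall>x\<in>interior K. \<forall>y\<in>interior K. 0 < y \<bullet> (matrix_of q *v x))}"

definition cone_nonneg :: "(real^'n) set \<Rightarrow> real^'n^'n \<Rightarrow> bool" where
  "cone_nonneg K A \<longleftrightarrow> (\<lambda>x. A *v x) ` K \<subseteq> K"

end

theory Submission
  imports Defs
begin

text \<open>
  Write \<open>K\<^sup>*\<close> for the dual cone. By the definition of \<open>K\<^sup>*\<close>, the inclusion \<open>Q K \<subseteq> K\<^sup>*\<close> says exactly that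
  the bilinear form \<open>y \<bullet> Q x\<close> is nonnegative on \<open>K \<times> K\<close>; since \<open>K = K\<^sup>*\<close>, this is
  \<open>K\<close>-nonnegativity of \<open>Q\<close>. The theorem therefore compares nonnegativity on \<open>K\<close> with strict
  positivity on the interior.

  Strict positivity on the interior extends to nonnegativity on \<open>K\<close> by continuity, because a
  self-dual convex cone is the closure of its interior: it is closed, and it is not contained in a
  hyperplane (lemma \<open>self_dual_interior_nonempty\<close>).

  Conversely, let \<open>Q\<close> be \<open>K\<close>-nonnegative and \<open>x\<close> an interior point. Pairing with an interior point
  is strictly positive on \<open>K - {0}\<close> (lemma \<open>interior_dual_cone_inner_pos\<close>), so it is enough that
  \<open>Q x \<noteq> 0\<close>. If \<open>Q x = 0\<close>, then by symmetry \<open>x \<bullet> Q z = Q x \<bullet> z = 0\<close> for every \<open>z\<close> in \<open>K\<close>, and as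
  \<open>Q z\<close> lies in \<open>K\<close> the same strictness forces \<open>Q z = 0\<close>. Thus \<open>Q\<close> vanishes on a set with an
  interior point, hence everywhere, which a positive eigenvalue rules out.
\<close>

lemma interior_point_perturb:
  fixes S :: "'a::real_normed_vector set"
  assumes "x \<in> interior S"
  obtains e where "0 < e" and "x + e *\<^sub>R v \<in> S"
proof -
  obtain d where d: "0 < d" "ball x d \<subseteq> S"
    using assms by (auto simp: mem_interior)
  define e where "e = d / (2 * (norm v + 1))"
  have pos: "0 < norm v + 1" by (simp add: add_nonneg_pos)
  then have e: "0 < e" using d(1) by (simp add: e_def)
  have "norm (e *\<^sub>R v) = e * norm v" using e by simp
  also have "\<dots> < e * (2 * (norm v + 1))"
    using e pos by simp
  also have "\<dots> = d" using pos by (simp add: e_def)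
  finally have "x + e *\<^sub>R v \<in> ball x d" by (simp add: dist_norm)
  then show thesis using that e d(2) by blast
qed

text \<open>An interior point can be moved a little against \<open>z\<close> without leaving the dual cone, so its
  pairing with \<open>z\<close> is bounded below by a positive multiple of \<open>z \<bullet> z\<close>.\<close>

lemma interior_dual_cone_inner_pos:
  fixes K :: "(real^'n) set"
  assumes "x \<in> interior (dual_cone K)" and "z \<in> K" and "z \<noteq> 0"
  shows "0 < x \<bullet> z"
proof -
  obtain e where e: "0 < e" "x + e *\<^sub>R (- z) \<in> dual_cone K"
    using interior_point_perturb[OF assms(1)] by blast
  then have "e * (z \<bullet> z) \<le> x \<bullet> z"
    using assms(2) by (auto simp: dual_cone_def inner_diff_left)
  moreover have "0 < e * (z \<bullet> z)" using e assms(3) by simp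
  ultimately show ?thesis by linarith
qed

lemma closed_dual_cone: "closed (dual_cone (K :: (real^'n) set))"
proof -
  have "dual_cone K = (\<Inter>x\<in>K. {y. x \<bullet> y \<ge> 0})"
    by (auto simp: dual_cone_def inner_commute)
  then show ?thesis by (simp add: closed_INT closed_halfspace_ge)
qed

lemma self_dual_mem_iff:
  fixes K :: "(real^'n) set"
  assumes "self_dual K"
  shows "v \<in> K \<longleftrightarrow> (\<forall>x\<in>K. 0 \<le> v \<bullet> x)"
proof -
  have "v \<in> K \<longleftrightarrow> v \<in> dual_cone K"
    using assms unfolding self_dual_def by (rule arg_cong)
  then show ?thesis by (simp only: dual_cone_def mem_Collect_eq)
qed

text \<open>Self-duality excludes a normal vector \<open>a\<close> of \<open>K\<close>: such an \<open>a\<close> lies in the dual cone, that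
  is, in \<open>K\<close>, and so is orthogonal to itself.\<close>

lemma self_dual_interior_nonempty:
  fixes K :: "(real^'n) set"
  assumes "convex_cone K" and "self_dual K"
  shows "interior K \<noteq> {}"
proof
  assume empty: "interior K = {}"
  have "convex K" using assms(1) by (simp add: convex_cone_def)
  then obtain a b where ab: "a \<noteq> 0" "K \<subseteq> {x. a \<bullet> x = b}"
    using empty by (rule empty_interior_subset_hyperplane)
  have "0 \<in> K" by (simp add: self_dual_mem_iff[OF assms(2), of 0])
  then have "b = 0" using ab(2) by auto
  then have K: "\<forall>x\<in>K. a \<bullet> x = 0" using ab(2) by auto
  then have "a \<in> K" by (simp add: self_dual_mem_iff[OF assms(2), of a])
  then show False using K ab(1) by auto
qed

lemma self_dual_closure_interior:
  fixes K :: "(real^'n) set"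
  assumes "convex_cone K" and "self_dual K"
  shows "closure (interior K) = K"
proof -
  have "convex K" using assms(1) by (simp add: convex_cone_def)
  then have "closure (interior K) = closure K"
    using self_dual_interior_nonempty[OF assms] by (rule convex_closure_interior)
  moreover have "closed K"
    using closed_dual_cone[of K] assms(2)[unfolded self_dual_def, symmetric] by (rule back_subst)
  ultimately show ?thesis by simp
qed

lemma cone_nonneg_iff_self_dual:
  fixes K :: "(real^'n) set"
  assumes "self_dual K"
  shows "cone_nonneg K A \<longleftrightarrow> (\<forall>x\<in>K. \<forall>y\<in>K. 0 \<le> y \<bullet> (A *v x))"
proof -
  have "v \<in> K \<longleftrightarrow> (\<forall>y\<in>K. 0 \<le> y \<bullet> v)" for v
    using self_dual_mem_iff[OF assms, of v] by (simp only: inner_commute)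
  then show ?thesis unfolding cone_nonneg_def by blast
qed

lemma bilinear_nonneg_closure:
  fixes S :: "(real^'n) set" and A :: "real^'n^'n"
  assumes "\<And>x y. x \<in> S \<Longrightarrow> y \<in> S \<Longrightarrow> 0 \<le> y \<bullet> (A *v x)"
    and "x \<in> closure S" and "y \<in> closure S"
  shows "0 \<le> y \<bullet> (A *v x)"
proof -
  have y: "0 \<le> y \<bullet> (A *v x)" if x: "x \<in> S" for x
  proof -
    have "continuous_on (closure S) (\<lambda>y. y \<bullet> (A *v x))"
      by (intro continuous_intros)
    then show ?thesis
      using assms(3) assms(1)[OF x] by (rule continuous_ge_on_closure)
  qed
  have "continuous_on (closure S) (\<lambda>x. y \<bullet> (A *v x))"
    by (intro continuous_on_inner continuous_on_const matrix_vector_mult_linear_continuous_on)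
  then show ?thesis
    using assms(2) y by (rule continuous_ge_on_closure)
qed

lemma symmetric_matrix_inner:
  fixes A :: "real^'n^'n"
  assumes "transpose A = A"
  shows "x \<bullet> (A *v y) = (A *v x) \<bullet> y"
  using dot_lmul_matrix[of x A y] transpose_matrix_vector[of A x] assms by simp

text \<open>A kernel vector in the interior would make \<open>A\<close> vanish on all of \<open>K\<close>, by strictness of the
  pairing with it;
  but \<open>K\<close> contains a neighbourhood of that vector, which spans the space.\<close>

lemma cone_nonneg_interior_nonzero:
  fixes K :: "(real^'n) set" and A :: "real^'n^'n"
  assumes "self_dual K" and "transpose A = A" and "cone_nonneg K A"
    and x: "x \<in> interior K" and v: "A *v v \<noteq> 0"
  shows "A *v x \<noteq> 0"
proof
  assume Ax: "A *v x = 0"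
  obtain e where e: "0 < e" "x + e *\<^sub>R v \<in> K"
    using interior_point_perturb[OF x] by blast
  define z where "z = x + e *\<^sub>R v"
  have "A *v z = e *\<^sub>R (A *v v)"
    by (simp add: z_def Ax matrix_vector_right_distrib matrix_vector_mult_scaleR)
  then have "A *v z \<noteq> 0" using e v by simp
  moreover have "A *v z \<in> K"
    using assms(3) e(2) by (auto simp: cone_nonneg_def z_def)
  moreover have "x \<in> interior (dual_cone K)"
    using assms(1) x unfolding self_dual_def by (rule subst)
  ultimately have "0 < x \<bullet> (A *v z)" using interior_dual_cone_inner_pos by blast
  then show False by (simp add: symmetric_matrix_inner[OF assms(2)] Ax)
qed

theorem corollary3p8:
  fixes K :: "(real^'n) set" and q :: "real^'n \<Rightarrow> real" and Q :: "real^'n^'n"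
  assumes "convex_cone K" and "self_dual K"
    and "quadratic_form q" and "Q = matrix_of q"
  shows "q \<in> SL2 K \<longleftrightarrow> one_positive_eigenvalue Q \<and> cone_nonneg K Q"
proof
  assume "q \<in> SL2 K"
  then have one: "one_positive_eigenvalue Q"
    and pos: "\<And>x y. x \<in> interior K \<Longrightarrow> y \<in> interior K \<Longrightarrow> 0 < y \<bullet> (Q *v x)"
    using assms(4) by (auto simp: SL2_def)
  have "0 \<le> y \<bullet> (Q *v x)" if "x \<in> K" "y \<in> K" for x y
    using that bilinear_nonneg_closure[of "interior K" Q x y] pos
    by (simp add: self_dual_closure_interior[OF assms(1,2)] less_imp_le)
  then show "one_positive_eigenvalue Q \<and> cone_nonneg K Q"
    using one by (simp add: cone_nonneg_iff_self_dual[OF assms(2)])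
next
  assume Q: "one_positive_eigenvalue Q \<and> cone_nonneg K Q"
  have sym: "transpose Q = Q"
    using assms(3,4) matrix_of_eq by (auto simp: quadratic_form_def has_matrix_def)
  obtain c v where "0 < c" "v \<noteq> 0" "Q *v v = c *\<^sub>R v"
    using Q unfolding one_positive_eigenvalue_def eigenvalue_def eigenspace_def by blast
  then have v: "Q *v v \<noteq> 0" by simp
  have "0 < y \<bullet> (Q *v x)" if x: "x \<in> interior K" and y: "y \<in> interior K" for x y
  proof (rule interior_dual_cone_inner_pos)
    show "y \<in> interior (dual_cone K)" using assms(2) y unfolding self_dual_def by (rule subst)
    show "Q *v x \<in> K"
      using Q x interior_subset by (auto simp: cone_nonneg_def)
    show "Q *v x \<noteq> 0"
      using cone_nonneg_interior_nonzero[OF assms(2) sym _ x v] Q by blast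
  qed
  then show "q \<in> SL2 K" using Q assms(3,4) by (auto simp: SL2_def)
qed

end
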